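(* Let $0<\epsilon\le2$ and let $B$ be the unit ball in $\mathbb{C}^n$. Let $\Omega\subset\mathbb{C}^n$ be a domain with $0\in\Omega$ and let $f$ be a toric psh function in $\Omega$ with an isolated singularity at $0$. Let $\varphi$ be a psh function on $\Omega$ such that $\varphi(z)\ge f(z)$ on a compact neighborhood $K\subset\Omega\cap B$ of $0$. Suppose that $\nu_{f,j}(0,1)>0$ for all $j=1,\dots,n$, and set $\nu=\max_{1\le j\le n}\nu_{f,j}(0,1)$. Let $u\in\mathcal{U}_\epsilon$. If $\nu<2n-2+\epsilon$, then the integral $$\int_K e^{-\varphi}(dd^cu)^n$$ is finite.
   Context: Psh means plurisubharmonic. A psh function $f$ is toric if $f(z_1,\dots,z_n)=f(|z_1|,\dots,|z_n|)$ depends only on the $|z_j|$. That $f$ has an isolated singularity at $0$ means $f(0)=-\infty$ and $f$ is locally bounded on $\Omega\setminus\{0\}$. For $j\in\{1,\dots,n\}$ let $f_j(\zeta)=f(0,\dots,0,\zeta,0,\dots,0)$ with $\zeta$ in the $j$-th position. Then $\nu_{f,j}(0,1)=\lim_{t\to-\infty}\frac{1}{t}\sup\{f_j(\zeta):|\zeta|=e^{t}\}$ (the partial like refined Lelong number of $f$). $\mathcal{F}^1_{m}(B)$ denotes the set of Hausdorff-Riesz measures of order $m$ on $B$: finite positive Borel measures $\mu$ on $B$ with $\mu(B(z,r)\cap B)\le r^{m}$ for all $z\in\overline{B}$ and $r>0$, where $B(z,r)$ is the ball of center $z$ and radius $r$. $\mathcal{U}_\epsilon$ is the set of functions $u$ for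 which there is $\mu\in\mathcal{F}^1_{2n-2+\epsilon}(B)$ such that $u$ is the unique solution of the Dirichlet problem: $u$ is psh on $B$ and continuous on $\overline{B}$, $(dd^cu)^n=d\mu$ in $B$, and $u=0$ on $\partial B$. Such a solution exists and is unique for each such $\mu$ (known theorem), and it is Hölder continuous on $\overline{B}$. $(dd^cu)^n$ is the Monge-Ampère measure in the sense of Bedford-Taylor. *)

theory Defs
  imports "HOL-Analysis.Analysis"
begin

text \<open>
  Points of \<open>\<complex>\<^sup>n\<close> are vectors of type \<open>complex ^ 'n\<close>, with \<open>n = CARD('n)\<close>. Functions with values in
  \<open>[-\<infinity>, \<infinity>)\<close> are rendered with values in \<open>ereal\<close>.
\<close>

section \<open>Plurisubharmonic functions\<close>

text \<open>
  The integral is the difference of the integrals of the positive and negative parts. For an upper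
  semicontinuous function with values in \<open>[-\<infinity>, \<infinity>)\<close> the first one is finite, so the difference is
  meaningful, possibly \<open>-\<infinity>\<close>.
\<close>

definition circle_mean :: "(real \<Rightarrow> ereal) \<Rightarrow> ereal" where
  "circle_mean g =
     enn2ereal (\<integral>\<^sup>+\<theta>. e2ennreal (g \<theta>) \<partial>uniform_measure lborel {0..2 * pi}) -
     enn2ereal (\<integral>\<^sup>+\<theta>. e2ennreal (- g \<theta>) \<partial>uniform_measure lborel {0..2 * pi})"

definition usc_on :: "('a::topological_space) set \<Rightarrow> ('a \<Rightarrow> ereal) \<Rightarrow> bool" where
  "usc_on D f \<longleftrightarrow> (\<forall>z\<in>D. \<forall>c. f z < c \<longrightarrow> (\<forall>\<^sub>F w in at z within D. f w < c))"

definition psh_on :: "(complex ^ 'n) set \<Rightarrow> (complex ^ 'n \<Rightarrow> ereal) \<Rightarrow> bool" where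
  "psh_on D f \<longleftrightarrow>
     open D \<and> (\<forall>z\<in>D. f z \<noteq> \<infinity>) \<and> usc_on D f \<and>
     (\<forall>z w. (\<forall>\<zeta>\<in>cball 0 1. z + \<zeta> *s w \<in> D) \<longrightarrow>
        f z \<le> circle_mean (\<lambda>\<theta>. f (z + cis \<theta> *s w)))"

definition toric_on :: "(complex ^ 'n) set \<Rightarrow> (complex ^ 'n \<Rightarrow> ereal) \<Rightarrow> bool" where
  "toric_on D f \<longleftrightarrow>
     (\<forall>z\<in>D. \<forall>w\<in>D. (\<forall>j. cmod (z $ j) = cmod (w $ j)) \<longrightarrow> f z = f w)"

definition isolated_singularity_at_0 :: "(complex ^ 'n) set \<Rightarrow> (complex ^ 'n \<Rightarrow> ereal) \<Rightarrow> bool" where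
  "isolated_singularity_at_0 D f \<longleftrightarrow>
     f 0 = -\<infinity> \<and>
     (\<forall>z\<in>D - {0}. \<exists>r>0. \<exists>M::real. \<forall>w\<in>ball z r \<inter> (D - {0}). \<bar>f w\<bar> \<le> ereal M)"

definition partial_lelong :: "(complex ^ 'n \<Rightarrow> ereal) \<Rightarrow> 'n \<Rightarrow> ereal" where
  "partial_lelong f j =
     Lim at_bot (\<lambda>t::real. (SUP \<zeta>\<in>{\<zeta>. cmod \<zeta> = exp t}. f (axis j \<zeta>)) / ereal t)"

definition exp_ereal :: "ereal \<Rightarrow> ennreal" where
  "exp_ereal x =
     (if x = \<infinity> then \<infinity> else if x = -\<infinity> then 0 else ennreal (exp (real_of_ereal x)))"

section \<open>Test functions and Radon functionals\<close>

primrec Ck :: "nat \<Rightarrow> (complex ^ 'n \<Rightarrow> complex) \<Rightarrow> bool" where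
  "Ck 0 f \<longleftrightarrow> continuous_on UNIV f"
| "Ck (Suc k) f \<longleftrightarrow>
     (\<forall>z. f differentiable (at z)) \<and> (\<forall>v. Ck k (\<lambda>z. frechet_derivative f (at z) v))"

definition fsupp :: "('a::topological_space \<Rightarrow> complex) \<Rightarrow> 'a set" where
  "fsupp \<psi> = closure {z. \<psi> z \<noteq> 0}"

definition Cc :: "(complex ^ 'n) set \<Rightarrow> (complex ^ 'n \<Rightarrow> complex) set" where
  "Cc D = {\<psi>. continuous_on UNIV \<psi> \<and> compact (fsupp \<psi>) \<and> fsupp \<psi> \<subseteq> D}"

definition Cc_smooth :: "(complex ^ 'n) set \<Rightarrow> (complex ^ 'n \<Rightarrow> complex) set" where
  "Cc_smooth D = {\<psi> \<in> Cc D. \<forall>k. Ck k \<psi>}"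

text \<open>Complex Radon measures on \<open>D\<close>, as functionals on \<open>Cc D\<close>.\<close>

definition radon :: "(complex ^ 'n) set \<Rightarrow> ((complex ^ 'n \<Rightarrow> complex) \<Rightarrow> complex) \<Rightarrow> bool" where
  "radon D T \<longleftrightarrow>
     (\<forall>\<psi>\<in>Cc D. \<forall>\<eta>\<in>Cc D. T (\<lambda>z. \<psi> z + \<eta> z) = T \<psi> + T \<eta>) \<and>
     (\<forall>\<psi>\<in>Cc D. \<forall>c. T (\<lambda>z. c * \<psi> z) = c * T \<psi>) \<and>
     (\<forall>K. compact K \<and> K \<subseteq> D \<longrightarrow>
        (\<exists>C. \<forall>\<psi>\<in>Cc D. \<forall>M. fsupp \<psi> \<subseteq> K \<and> (\<forall>z. cmod (\<psi> z) \<le> M) \<longrightarrow> cmod (T \<psi>) \<le> C * M))"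

section \<open>The Bedford-Taylor Monge-Ampere measure\<close>

text \<open>
  Wirtinger derivatives, in terms of the real directional derivatives along \<open>axis j 1\<close> and
  \<open>axis j \<i>\<close>.
\<close>

definition dz :: "'n \<Rightarrow> (complex ^ 'n \<Rightarrow> complex) \<Rightarrow> complex ^ 'n \<Rightarrow> complex" where
  "dz j f z =
     (frechet_derivative f (at z) (axis j 1) - \<i> * frechet_derivative f (at z) (axis j \<i>)) / 2"

definition dzbar :: "'n \<Rightarrow> (complex ^ 'n \<Rightarrow> complex) \<Rightarrow> complex ^ 'n \<Rightarrow> complex" where
  "dzbar j f z =
     (frechet_derivative f (at z) (axis j 1) + \<i> * frechet_derivative f (at z) (axis j \<i>)) / 2"

text \<open>
  A current \<open>T\<close> of bidegree \<open>(k,k)\<close> and order \<open>0\<close> on \<open>D\<close> is given by its values on the forms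
  \<open>\<psi> \<cdot> (i dz\<^bsub>a1\<^esub> \<and> dz\<^bsub>b1\<^esub>\<^sup>-) \<and> \<dots> \<and> (i dz\<^bsub>am\<^esub> \<and> dz\<^bsub>bm\<^esub>\<^sup>-)\<close> with \<open>m = n - k\<close> and \<open>\<psi>\<close> in \<open>Cc D\<close>, which span
  the continuous \<open>(m,m)\<close>-forms with compact support in \<open>D\<close>. The value is written
  \<open>T [(a1,b1), \<dots>, (am,bm)] \<psi>\<close>; values at lists of another length have no meaning. The factors are
  \<open>2\<close>-forms, so they commute and no signs arise when one is added.

  With \<open>d\<^sup>c = i (\<partial>\<^sup>- - \<partial>)\<close>, hence \<open>dd\<^sup>c = 2 i \<partial> \<partial>\<^sup>-\<close>, one has
  \<open>dd\<^sup>c \<psi> = \<Sum>\<^bsub>a,b\<^esub> 2 (\<partial>\<^sup>2 \<psi> / \<partial>z\<^sub>a \<partial>z\<^sub>b\<^sup>-) i dz\<^sub>a \<and> dz\<^sub>b\<^sup>-\<close>.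
  \<open>ddc_power D u k T\<close> states \<open>T = (dd\<^sup>c u)\<^sup>k\<close> on \<open>D\<close>, where, as in Bedford-Taylor,
  \<open>dd\<^sup>c u \<and> S = dd\<^sup>c (u S)\<close>, that is, \<open>(dd\<^sup>c u \<and> S)(\<omega>) = S (u dd\<^sup>c \<omega>)\<close> for smooth test forms \<open>\<omega>\<close>; the result is
  extended to continuous forms as a current of order \<open>0\<close>. Since \<open>u\<close> is assumed continuous on \<open>D\<close>, the
  coefficients of \<open>u dd\<^sup>c \<omega>\<close> lie in \<open>Cc D\<close>.

  In the base case \<open>T\<close> is integration over \<open>D\<close> of \<open>(n,n)\<close>-forms. The determinant is the sign of the
  permutation sending each \<open>a\<^sub>l\<close> to \<open>b\<^sub>l\<close>, and \<open>0\<close> if \<open>L\<close> is not the graph of a permutation; the power of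
  \<open>2\<close> comes from \<open>i dz\<^sub>j \<and> dz\<^sub>j\<^sup>- = 2 dx\<^sub>j \<and> dy\<^sub>j\<close>.
\<close>

type_synonym 'n current = "('n \<times> 'n) list \<Rightarrow> (complex ^ 'n \<Rightarrow> complex) \<Rightarrow> complex"

primrec ddc_power ::
    "(complex ^ 'n) set \<Rightarrow> (complex ^ 'n \<Rightarrow> real) \<Rightarrow> nat \<Rightarrow> 'n current \<Rightarrow> bool" where
  "ddc_power D u 0 T \<longleftrightarrow>
     (\<forall>L. length L = CARD('n) \<longrightarrow> (\<forall>\<psi>\<in>Cc D.
        T L \<psi> = 2 ^ CARD('n) * det (\<chi> a b. if (a, b) \<in> set L then 1 else 0) *
                (\<integral>z. \<psi> z \<partial>lborel)))"
| "ddc_power D u (Suc k) T \<longleftrightarrow>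
     (\<exists>S. ddc_power D u k S \<and>
        (\<forall>L. length L + Suc k = CARD('n) \<longrightarrow>
           radon D (T L) \<and>
           (\<forall>\<psi>\<in>Cc_smooth D.
              T L \<psi> = (\<Sum>a\<in>UNIV. \<Sum>b\<in>UNIV.
                         S ((a, b) # L) (\<lambda>z. of_real (u z) * (2 * dz a (dzbar b \<psi>) z))))))"

definition has_monge_ampere ::
    "(complex ^ 'n) set \<Rightarrow> (complex ^ 'n \<Rightarrow> real) \<Rightarrow> (complex ^ 'n) measure \<Rightarrow> bool" where
  "has_monge_ampere D u \<mu> \<longleftrightarrow>
     sets \<mu> = sets (restrict_space borel D) \<and>
     (\<forall>K. compact K \<and> K \<subseteq> D \<longrightarrow> emeasure \<mu> K < \<infinity>) \<and>
     (\<exists>T. ddc_power D u CARD('n) T \<and> (\<forall>\<psi>\<in>Cc D. T [] \<psi> = (\<integral>z. \<psi> z \<partial>\<mu>)))"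

text \<open>
  For \<open>u\<close> psh and continuous on the open set \<open>D\<close> there is exactly one such measure: the
  currents \<open>(dd\<^sup>c u)\<^sup>k\<close> are positive, hence of order \<open>0\<close>, and the extensions are unique because \<open>Cc_smooth D\<close>
  is dense in \<open>Cc D\<close>.
\<close>

definition monge_ampere ::
    "(complex ^ 'n) set \<Rightarrow> (complex ^ 'n \<Rightarrow> real) \<Rightarrow> (complex ^ 'n) measure" where
  "monge_ampere D u = (THE \<mu>. has_monge_ampere D u \<mu>)"

section \<open>Hausdorff-Riesz measures and the Dirichlet problem\<close>

definition hausdorff_riesz :: "real \<Rightarrow> (complex ^ 'n) measure set" where
  "hausdorff_riesz m =
     {\<mu>. finite_measure \<mu> \<and> sets \<mu> = sets (restrict_space borel (ball 0 1)) \<and>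
         (\<forall>z\<in>cball 0 1. \<forall>r>0. measure \<mu> (ball z r \<inter> ball 0 1) \<le> r powr m)}"

definition solves_dirichlet :: "(complex ^ 'n) measure \<Rightarrow> (complex ^ 'n \<Rightarrow> real) \<Rightarrow> bool" where
  "solves_dirichlet \<mu> u \<longleftrightarrow>
     psh_on (ball 0 1) (\<lambda>z. ereal (u z)) \<and> continuous_on (cball 0 1) u \<and>
     monge_ampere (ball 0 1) u = \<mu> \<and> (\<forall>z\<in>sphere 0 1. u z = 0)"

definition U_eps :: "real \<Rightarrow> (complex ^ 'n \<Rightarrow> real) set" where
  "U_eps \<epsilon> = {u. \<exists>\<mu>\<in>hausdorff_riesz (2 * real CARD('n) - 2 + \<epsilon>). solves_dirichlet \<mu> u}"

end

theory Submission
  imports Defs "HOL-Complex_Analysis.Cauchy_Integral_Formula"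
begin

text \<open>
  The measure enters only through its growth: \<open>(dd\<^sup>c u)\<^sup>n\<close> is a Hausdorff-Riesz measure \<open>\<mu>\<close> of order
  \<open>m = 2n - 2 + \<epsilon>\<close>, so the dyadic shells around \<open>0\<close> have mass at most \<open>2\<^sup>-\<^sup>i\<^sup>m\<close> and \<open>|z|\<^sup>-\<^sup>a\<close> is
  \<open>\<mu>\<close>-integrable for every \<open>a < m\<close> (\<open>hausdorff_riesz_power_integral_finite\<close>). Hence it suffices to show
  \<open>f(z) \<ge> a ln |z| - C\<close> near \<open>0\<close> for some \<open>a\<close> strictly between \<open>\<nu>\<close> and \<open>m\<close>; away from \<open>0\<close> the function
  \<open>f\<close> is bounded on \<open>K\<close> by compactness, and \<open>e\<^sup>-\<^sup>\<phi> \<le> e\<^sup>-\<^sup>f\<close> on \<open>K\<close>.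

  The lower bound on \<open>f\<close> reduces to the coordinate axes (\<open>toric_psh_ge_axis\<close>): rotating all coordinates of
  \<open>z\<close> except the \<open>j\<close>-th does not change the toric function \<open>f\<close>, and the average of \<open>f\<close> over these rotations
  is at least its value at the centre \<open>(0, \<dots>, z\<^sub>j, \<dots>, 0)\<close>. Choosing for \<open>j\<close> the largest coordinate costs
  only a factor \<open>n\<close> inside the logarithm.

  On the \<open>j\<close>-th axis \<open>f\<close> is a radial subharmonic function \<open>k(|\<zeta>|)\<close>. If \<open>k(e\<^sup>t)/t\<close> tends to the partial
  Lelong number, then \<open>k(e\<^sup>t) > a t\<close> as \<open>t \<rightarrow> -\<infinity>\<close>, which is the bound wanted. The substance is that
  this limit exists (\<open>partial_lelong_limit\<close>): the partial Lelong number is the value of a limit operator and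
  carries no information otherwise. Existence follows from convexity of \<open>t \<mapsto> k(e\<^sup>t)\<close> (\<open>log_convex_radial\<close>,
  Hadamard's three circles theorem), because the slopes of a convex function are monotone.
\<close>

section \<open>Circle means\<close>

lemma circle_mean_mono:
  assumes "\<And>\<theta>. g \<theta> \<le> h \<theta>"
  shows "circle_mean g \<le> circle_mean h"
  unfolding circle_mean_def
  by (intro ereal_minus_mono iffD1[OF less_eq_ennreal.rep_eq] nn_integral_mono e2ennreal_mono)
     (simp_all add: assms)

lemma circle_mean_continuous:
  fixes q :: "real \<Rightarrow> real"
  assumes q: "continuous_on UNIV q" and I: "(q has_integral I) {0..2 * pi}"
  shows "circle_mean (\<lambda>\<theta>. ereal (q \<theta>)) = ereal (I / (2 * pi))"
proof -
  let ?P = "uniform_measure lborel {0..2 * pi} :: real measure"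
  (* The normalized Lebesgue measure in circle_mean is written as a density, so that both parts of the
     mean reduce to integrals over the real line. *)
  let ?w = "\<lambda>x::real. indicator {0..2 * pi} x / (2 * pi)"
  have P: "?P = density lborel ?w"
    unfolding uniform_measure_def
    by (intro density_cong)
       (auto simp: ennreal_indicator[symmetric] divide_ennreal indicator_def
             simp flip: ennreal_1 ennreal_mult'')
  have set_int: "set_integrable lborel {0..2 * pi} q"
    using q by (intro borel_integrable_atLeastAtMost') (auto intro: continuous_on_subset)
  have qm: "q \<in> borel_measurable lborel"
    using q by (simp add: borel_measurable_continuous_onI)
  have scale: "?w x *\<^sub>R q x = (1 / (2 * pi)) * (indicator {0..2 * pi} x *\<^sub>R q x)" for x
    by simp
  have int: "integrable ?P q"
  proof -
    have "integrable lborel (\<lambda>x. ?w x *\<^sub>R q x)"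
      unfolding scale using set_int unfolding set_integrable_def by (rule integrable_mult_right)
    then show ?thesis
      unfolding P using qm by (subst integrable_density) auto
  qed
  have "integral\<^sup>L ?P q = (\<integral>x. ?w x *\<^sub>R q x \<partial>lborel)"
    unfolding P using qm by (subst integral_density) auto
  also have "\<dots> = (1 / (2 * pi)) * (LBINT x:{0..2 * pi}. q x)"
    unfolding scale set_lebesgue_integral_def by (rule integral_mult_right_zero)
  also have "(LBINT x:{0..2 * pi}. q x) = I"
    using set_borel_integral_eq_integral(2)[OF set_int] I by (simp add: integral_unique)
  finally have mean: "integral\<^sup>L ?P q = I / (2 * pi)" by simp
  have fin: "(\<integral>\<^sup>+x. ennreal (q x) \<partial>?P) < \<infinity>" "(\<integral>\<^sup>+x. ennreal (- q x) \<partial>?P) < \<infinity>"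
    using int by (auto simp: real_integrable_def top.not_eq_extremum)
  have *: "enn2ereal x = ereal (enn2real x)" if "x < \<infinity>" for x
    using that by (cases x) auto
  show ?thesis
    unfolding circle_mean_def using fin mean real_lebesgue_integral_def[OF int]
    by (simp add: * flip: ennreal.rep_eq)
qed

text \<open>
  The mean value property of the harmonic function \<open>ln |w|\<close> on a disc that misses the origin: it is the
  real part of the principal logarithm, to which Cauchy's integral formula applies.
\<close>

lemma ln_circle_mean:
  fixes r \<rho> :: real
  assumes "0 < \<rho>" "\<rho> < r"
  shows "((\<lambda>\<theta>. ln (cmod (of_real r + of_real \<rho> * cis \<theta>))) has_integral 2 * pi * ln r) {0..2 * pi}"
proof -
  have off: "w \<notin> \<real>\<^sub>\<le>\<^sub>0" if "w \<in> cball (of_real r) \<rho>" for w :: complex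
  proof -
    have "\<bar>Re (of_real r - w)\<bar> \<le> \<rho>"
      using that abs_Re_le_cmod[of "of_real r - w"] by (auto simp: dist_norm)
    then show ?thesis using assms by (auto simp: complex_nonpos_Reals_iff)
  qed
  have "((\<lambda>w. Ln w / (w - of_real r)) has_contour_integral 2 * of_real pi * \<i> * Ln (of_real r))
      (circlepath (of_real r) \<rho>)"
    using assms off
    by (intro Cauchy_integral_circlepath_simple) (auto intro!: holomorphic_intros)
  then have "((\<lambda>t. Ln (of_real r + of_real \<rho> * cis t) * \<i>) has_integral 2 * pi * \<i> * Ln (of_real r))
      {0..2 * pi}"
    using assms
    by (simp add: circlepath_def has_contour_integral_part_circlepath_iff)
  from has_integral_mult_right[OF this, of "- \<i>"]
  have "((\<lambda>t. Ln (of_real r + of_real \<rho> * cis t)) has_integral 2 * pi * Ln (of_real r)) {0..2 * pi}"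
    by (simp add: mult_ac)
  from has_integral_Re[OF this]
  have "((\<lambda>t. Re (Ln (of_real r + of_real \<rho> * cis t))) has_integral 2 * pi * ln r) {0..2 * pi}"
    using assms by (simp add: Ln_of_real)
  moreover have "Re (Ln (of_real r + of_real \<rho> * cis t)) = ln (cmod (of_real r + of_real \<rho> * cis t))" for t
    using off[of "of_real r + of_real \<rho> * cis t"] assms
    by (intro Re_Ln) (auto simp: dist_norm norm_mult)
  ultimately show ?thesis by simp
qed

lemma cmod_circle_squared:
  fixes r \<rho> \<theta> :: real
  shows "(cmod (of_real r + of_real \<rho> * cis \<theta>))\<^sup>2 = r\<^sup>2 + \<rho>\<^sup>2 + 2 * r * \<rho> * cos \<theta>"
proof -
  have "(cmod (of_real r + of_real \<rho> * cis \<theta>))\<^sup>2 = (r + \<rho> * cos \<theta>)\<^sup>2 + (\<rho> * sin \<theta>)\<^sup>2"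
    by (simp add: cmod_power2)
  also have "\<dots> = r\<^sup>2 + \<rho>\<^sup>2 * ((sin \<theta>)\<^sup>2 + (cos \<theta>)\<^sup>2) + 2 * r * \<rho> * cos \<theta>"
    unfolding power2_eq_square by algebra
  finally show ?thesis by simp
qed

lemma square_circle_mean:
  fixes r \<rho> :: real
  shows "((\<lambda>\<theta>. (cmod (of_real r + of_real \<rho> * cis \<theta>))\<^sup>2) has_integral 2 * pi * (r\<^sup>2 + \<rho>\<^sup>2)) {0..2 * pi}"
proof -
  have "((\<lambda>\<theta>. r\<^sup>2 + \<rho>\<^sup>2 + 2 * r * \<rho> * cos \<theta>) has_integral
      ((r\<^sup>2 + \<rho>\<^sup>2) * (2 * pi) + 2 * r * \<rho> * sin (2 * pi)) - ((r\<^sup>2 + \<rho>\<^sup>2) * 0 + 2 * r * \<rho> * sin 0)) {0..2 * pi}"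
    by (intro fundamental_theorem_of_calculus)
       (auto intro!: derivative_eq_intros simp flip: has_real_derivative_iff_has_vector_derivative)
  then show ?thesis unfolding cmod_circle_squared by (simp add: mult_ac)
qed

section \<open>Radial subharmonic functions\<close>

lemma usc_attains_sup:
  fixes V :: "'a::topological_space \<Rightarrow> real"
  assumes "compact S" "S \<noteq> {}"
    and usc: "\<And>x c. x \<in> S \<Longrightarrow> V x < c \<Longrightarrow> \<forall>\<^sub>F y in at x within S. V y < c"
  shows "\<exists>x\<in>S. \<forall>y\<in>S. V y \<le> V x"
proof (rule ccontr)
  assume "\<not> ?thesis"
  then have above: "\<exists>y\<in>S. V x < V y" if "x \<in> S" for x
    using that by (force simp: not_le)
  define U where "U y = \<Union>{W. open W \<and> (\<forall>x\<in>W \<inter> S. V x < V y)}" for y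
  have U: "V x < V y" if "x \<in> U y" "x \<in> S" for x y
    using that by (auto simp: U_def)
  have mem: "x \<in> U y" if xy: "x \<in> S" "V x < V y" for x y
  proof -
    obtain W where "open W" "x \<in> W" "\<forall>z\<in>W. z \<noteq> x \<longrightarrow> z \<in> S \<longrightarrow> V z < V y"
      using usc[OF xy] unfolding eventually_at_topological by blast
    then have "W \<in> {W. open W \<and> (\<forall>x\<in>W \<inter> S. V x < V y)}" using xy by auto
    then show ?thesis unfolding U_def using \<open>x \<in> W\<close> by (rule UnionI)
  qed
  have "S \<subseteq> (\<Union>y\<in>S. U y)"
  proof
    fix x assume "x \<in> S"
    with above obtain y where "y \<in> S" "V x < V y" by blast
    then show "x \<in> (\<Union>y\<in>S. U y)" using mem \<open>x \<in> S\<close> by blast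
  qed
  moreover have "open (U y)" for y by (auto simp: U_def)
  ultimately obtain C where C: "C \<subseteq> S" "finite C" "S \<subseteq> (\<Union>y\<in>C. U y)"
    using compactE_image[OF \<open>compact S\<close>, of S U] by metis
  then have "C \<noteq> {}" using \<open>S \<noteq> {}\<close> by auto
  then have "Max (V ` C) \<in> V ` C" using C by (intro Max_in) auto
  then obtain x where x: "x \<in> C" "V x = Max (V ` C)" by auto
  then obtain y where y: "y \<in> C" "x \<in> U y" using C by blast
  then have "V x < V y" using U x C by blast
  moreover have "V y \<le> V x" using x y C by simp
  ultimately show False by simp
qed

text \<open>
  The maximum principle for \<open>k(|\<zeta>|)\<close> minus the harmonic function \<open>\<alpha> ln |\<zeta>| + \<beta>\<close>. The perturbation
  \<open>\<delta> |\<zeta>|\<^sup>2\<close> makes the difference strictly subharmonic, so that one circle around an interior maximum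
  already gives a contradiction. There \<open>k\<close> lies below a continuous majorant on the circle, and the mean of
  the majorant can be computed exactly.
\<close>

lemma three_circles:
  fixes k :: "real \<Rightarrow> real"
  assumes usc: "\<And>r c. 0 < r \<Longrightarrow> r < R \<Longrightarrow> k r < c \<Longrightarrow> \<forall>\<^sub>F s in at r. k s < c"
    and submean: "\<And>r \<rho>. 0 < \<rho> \<Longrightarrow> \<rho> < r \<Longrightarrow> r + \<rho> < R \<Longrightarrow>
      ereal (k r) \<le> circle_mean (\<lambda>\<theta>. ereal (k (cmod (of_real r + of_real \<rho> * cis \<theta>))))"
    and ab: "0 < a" "a < b" "b < R"
    and ka: "k a \<le> \<alpha> * ln a + \<beta>" and kb: "k b \<le> \<alpha> * ln b + \<beta>"
    and r: "a \<le> r" "r \<le> b"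
  shows "k r \<le> \<alpha> * ln r + \<beta>"
proof (rule ccontr)
  define \<eta> where "\<eta> = k r - (\<alpha> * ln r + \<beta>)"
  assume "\<not> ?thesis"
  then have "\<eta> > 0" by (simp add: \<eta>_def)
  (* Small enough that the perturbation cannot lift the boundary values up to the violation eta. *)
  define \<delta> where "\<delta> = \<eta> / (2 * b\<^sup>2)"
  have "\<delta> > 0" "\<delta> * b\<^sup>2 < \<eta>" using \<open>\<eta> > 0\<close> ab by (auto simp: \<delta>_def)
  define l where "l s = - \<alpha> * ln s - \<beta> + \<delta> * s\<^sup>2" for s
  have "\<exists>x\<in>{a..b}. \<forall>y\<in>{a..b}. k y + l y \<le> k x + l x"
  proof (rule usc_attains_sup)
    fix x c assume x: "x \<in> {a..b}" and less: "k x + l x < c"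
    define e where "e = (c - (k x + l x)) / 2"
    have "e > 0" using less by (simp add: e_def)
    have "\<forall>\<^sub>F s in at x. k s < k x + e"
      using usc[of x "k x + e"] x ab \<open>e > 0\<close> by auto
    moreover have "(l \<longlongrightarrow> l x) (at x)"
      unfolding l_def using x ab by (auto intro!: tendsto_eq_intros)
    then have "\<forall>\<^sub>F s in at x. l s < l x + e"
      using \<open>e > 0\<close> by (auto intro: order_tendstoD)
    ultimately have "\<forall>\<^sub>F s in at x. k s + l s < c"
      by eventually_elim (auto simp: e_def field_simps)
    then show "\<forall>\<^sub>F s in at x within {a..b}. k s + l s < c"
      using at_le[of "{a..b}" UNIV x] by (auto simp: le_filter_def)
  qed (use ab in auto)
  then obtain x where x: "x \<in> {a..b}" and max: "\<And>y. y \<in> {a..b} \<Longrightarrow> k y + l y \<le> k x + l x"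
    by blast
  have "\<eta> \<le> k x + l x"
  proof -
    have "\<eta> + \<delta> * r\<^sup>2 = k r + l r" by (simp add: \<eta>_def l_def)
    moreover have "0 \<le> \<delta> * r\<^sup>2" using \<open>\<delta> > 0\<close> by simp
    ultimately show ?thesis using max[of r] r by simp
  qed
  have "a\<^sup>2 \<le> b\<^sup>2" using ab by (intro power_mono) auto
  then have "\<delta> * a\<^sup>2 \<le> \<delta> * b\<^sup>2" using \<open>\<delta> > 0\<close> by simp
  have "x \<noteq> a" "x \<noteq> b"
    using \<open>\<eta> \<le> k x + l x\<close> \<open>\<delta> * a\<^sup>2 \<le> \<delta> * b\<^sup>2\<close> ka kb \<open>\<delta> * b\<^sup>2 < \<eta>\<close> by (auto simp: l_def)
  define \<rho> where "\<rho> = min (x - a) (b - x)"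
  have \<rho>: "0 < \<rho>" "\<rho> \<le> x - a" "\<rho> \<le> b - x" "\<rho> < x" "x + \<rho> < R"
    using x \<open>x \<noteq> a\<close> \<open>x \<noteq> b\<close> ab by (auto simp: \<rho>_def)
  let ?s = "\<lambda>\<theta>. cmod (of_real x + of_real \<rho> * cis \<theta>)"
  have s: "?s \<theta> \<in> {a..b}" for \<theta>
  proof -
    have "?s \<theta> \<le> x + \<rho>" "x - \<rho> \<le> ?s \<theta>"
      using norm_triangle_ineq[of "of_real x" "of_real \<rho> * cis \<theta>"]
        norm_triangle_ineq2[of "of_real x" "- (of_real \<rho> * cis \<theta>)"] \<rho> x ab
      by (auto simp: norm_mult)
    then show ?thesis using \<rho> by auto
  qed
  (* Maximality at x says that k is at most q on the circle, and q has mean k x - \<delta> * \<rho>\<^sup>2. *)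
  define q where "q \<theta> = k x + l x + \<alpha> * ln (?s \<theta>) + \<beta> - \<delta> * (?s \<theta>)\<^sup>2" for \<theta>
  have "k (?s \<theta>) \<le> q \<theta>" for \<theta>
    using max[OF s[of \<theta>]] by (simp add: q_def l_def)
  then have "ereal (k x) \<le> circle_mean (\<lambda>\<theta>. ereal (q \<theta>))"
    using submean[of \<rho> x] \<rho> by (meson circle_mean_mono ereal_less_eq(3) order_trans)
  also have "\<dots> = ereal ((2 * pi * (k x - \<delta> * \<rho>\<^sup>2)) / (2 * pi))"
  proof (rule circle_mean_continuous)
    have "0 < ?s \<theta>" for \<theta> using s[of \<theta>] ab by auto
    then have "?s \<theta> \<noteq> 0" for \<theta> by (metis less_irrefl)
    then show "continuous_on UNIV q"
      unfolding q_def by (intro continuous_intros) auto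
    have "((\<lambda>\<theta>. (k x + l x) + \<alpha> * ln (?s \<theta>) + \<beta> - \<delta> * (?s \<theta>)\<^sup>2) has_integral
       ((k x + l x) * (2 * pi) + \<alpha> * (2 * pi * ln x) + \<beta> * (2 * pi) - \<delta> * (2 * pi * (x\<^sup>2 + \<rho>\<^sup>2)))) {0..2 * pi}"
      using has_integral_const_real[of "k x + l x" 0 "2 * pi"] has_integral_const_real[of \<beta> 0 "2 * pi"]
      by (intro has_integral_add has_integral_diff has_integral_mult_right ln_circle_mean square_circle_mean \<rho>)
         (simp_all add: mult_ac)
    then show "(q has_integral 2 * pi * (k x - \<delta> * \<rho>\<^sup>2)) {0..2 * pi}"
      by (simp add: q_def[abs_def] l_def algebra_simps)
  qed
  finally have "k x \<le> k x - \<delta> * \<rho>\<^sup>2" by simp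
  then show False using \<open>\<delta> > 0\<close> \<rho> by (simp add: mult_le_0_iff)
qed

text \<open>
  Convexity says that the graph lies below its chords; in the variable \<open>r = e\<^sup>t\<close> a chord is a function
  \<open>\<alpha> ln r + \<beta>\<close>, so this is the three circles estimate.
\<close>

lemma log_convex_radial:
  fixes k :: "real \<Rightarrow> real"
  assumes usc: "\<And>r c. 0 < r \<Longrightarrow> r < R \<Longrightarrow> k r < c \<Longrightarrow> \<forall>\<^sub>F s in at r. k s < c"
    and submean: "\<And>r \<rho>. 0 < \<rho> \<Longrightarrow> \<rho> < r \<Longrightarrow> r + \<rho> < R \<Longrightarrow>
      ereal (k r) \<le> circle_mean (\<lambda>\<theta>. ereal (k (cmod (of_real r + of_real \<rho> * cis \<theta>))))"
    and "0 < R"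
  shows "convex_on {..<ln R} (\<lambda>t. k (exp t))"
proof (rule convex_on_linorderI)
  fix t x y :: real
  assume t: "0 < t" "t < 1" and xy: "x \<in> {..<ln R}" "y \<in> {..<ln R}" "x < y"
  define \<alpha> where "\<alpha> = (k (exp y) - k (exp x)) / (y - x)"
  define p where "p = (1 - t) * x + t * y"
  have p: "p - x = t * (y - x)" "y - p = (1 - t) * (y - x)" by (simp_all add: p_def algebra_simps)
  then have "x \<le> p" "p \<le> y" using t xy
    by (smt (verit) mult_nonneg_nonneg)+
  have \<alpha>: "\<alpha> * (y - x) = k (exp y) - k (exp x)" using xy by (simp add: \<alpha>_def)
  have "exp y < R" using xy \<open>0 < R\<close> by (metis exp_less_mono exp_ln lessThan_iff)
  have "k (exp p) \<le> \<alpha> * ln (exp p) + (k (exp x) - \<alpha> * x)"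
  proof (rule three_circles[where a = "exp x" and b = "exp y" and R = R])
    show "k (exp y) \<le> \<alpha> * ln (exp y) + (k (exp x) - \<alpha> * x)"
      using \<alpha> by (simp add: algebra_simps)
  qed (use \<open>exp y < R\<close> \<open>x \<le> p\<close> \<open>p \<le> y\<close> xy in \<open>simp_all add: usc submean\<close>)
  also have "\<dots> = k (exp x) + \<alpha> * (p - x)" by (simp add: right_diff_distrib)
  also have "\<dots> = k (exp x) + t * (\<alpha> * (y - x))" unfolding p(1) by (simp add: mult_ac)
  also have "\<dots> = (1 - t) * k (exp x) + t * k (exp y)" unfolding \<alpha> by (simp add: algebra_simps)
  finally show "k (exp ((1 - t) *\<^sub>R x + t *\<^sub>R y)) \<le> (1 - t) * k (exp x) + t * k (exp y)"
    by (simp add: p_def)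
qed simp

text \<open>
  The slopes \<open>s t\<close> from a fixed point \<open>a\<close> are monotone, and they are bounded below because \<open>g \<le> c\<close>
  near \<open>-\<infinity>\<close>, which keeps the slopes with \<open>a - t \<ge> 1\<close> above \<open>- \<bar>g a - c\<bar>\<close>. So \<open>s t\<close> converges,
  and \<open>g t / t\<close> has the same limit, since replacing \<open>g t / t\<close> by \<open>s t\<close> changes numerator and denominator
  by constants only.
\<close>

lemma convex_slope_at_bot:
  fixes g :: "real \<Rightarrow> real"
  assumes conv: "convex_on {..<T} g" and bdd: "\<forall>\<^sub>F t in at_bot. g t \<le> c"
  shows "\<exists>L. ((\<lambda>t. g t / t) \<longlongrightarrow> L) at_bot"
proof -
  define a where "a = T - 1"
  define s where "s t = (g a - g t) / (a - t)" for t
  have mono: "s x \<le> s y" if "x \<le> y" "y < a" for x y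
  proof (cases "x = y")
    case False
    then show ?thesis
      using convex_on_slope_le(2)[OF conv, of x a y] convex_on_slope_le(1)[OF conv, of x a y] that
      by (simp add: s_def a_def) (smt (verit) minus_divide_divide)
  qed simp
  obtain N where N: "\<And>t. t \<le> N \<Longrightarrow> g t \<le> c"
    using bdd by (auto simp: eventually_at_bot_linorder)
  have lower: "- \<bar>g a - c\<bar> \<le> s t" if "t < a" for t
  proof -
    (* A point so far left that g x \<le> c, that x \<le> t, and that the denominator a - x is at least 1. *)
    define x where "x = min (min t N) (a - 1)"
    have x: "x \<le> t" "x \<le> N" "x \<le> a - 1" by (auto simp: x_def)
    have "- \<bar>g a - c\<bar> * (a - x) \<le> - \<bar>g a - c\<bar> * 1"
      using x by (intro mult_left_mono_neg) auto
    also have "\<dots> \<le> g a - g x" using N[of x] x by auto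
    finally have "- \<bar>g a - c\<bar> \<le> s x" using x by (simp add: s_def field_simps)
    then show ?thesis using mono[of x t] x that by simp
  qed
  define L where "L = Inf (s ` {..<a})"
  have bb: "bdd_below (s ` {..<a})" using lower by (auto simp: bdd_below_def)
  have "(s \<longlongrightarrow> L) at_bot"
  proof (rule order_tendstoI)
    fix y assume "y < L"
    have "y < s t" if "t < a" for t
      using cInf_lower[OF _ bb, of "s t"] that \<open>y < L\<close> by (auto simp: L_def)
    then show "\<forall>\<^sub>F t in at_bot. y < s t"
      unfolding eventually_at_bot_dense by blast
  next
    fix y assume "L < y"
    then obtain x where x: "x < a" "s x < y"
      unfolding L_def using bb by (subst (asm) cInf_less_iff) (auto simp: lessThan_def intro: lt_ex)
    then have "s t < y" if "t \<le> x" for t using mono[OF that] by simp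
    then show "\<forall>\<^sub>F t in at_bot. s t < y"
      by (auto simp: eventually_at_bot_linorder)
  qed
  have inv: "((\<lambda>t::real. inverse t) \<longlongrightarrow> 0) at_bot" 
    by (rule tendsto_mono[OF at_bot_le_at_infinity tendsto_inverse_0])
  have "((\<lambda>t. g a * inverse t + s t * (1 - a * inverse t)) \<longlongrightarrow> g a * 0 + L * (1 - a * 0)) at_bot"
    by (intro tendsto_intros inv \<open>(s \<longlongrightarrow> L) at_bot\<close>)
  moreover have "\<forall>\<^sub>F t in at_bot. g a * inverse t + s t * (1 - a * inverse t) = g t / t"
    using eventually_gt_at_bot[of a] eventually_gt_at_bot[of 0]
  proof eventually_elim
    case (elim t)
    have "s t * (1 - a * inverse t) = (s t * (a - t)) * (- inverse t)"
      using elim by (simp add: field_simps)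
    also have "s t * (a - t) = g a - g t" using elim by (simp add: s_def)
    finally show ?case by (simp add: divide_inverse left_diff_distrib)
  qed
  ultimately have "((\<lambda>t. g t / t) \<longlongrightarrow> g a * 0 + L * (1 - a * 0)) at_bot"
    by (rule Lim_transform_eventually)
  then show ?thesis by blast
qed

section \<open>Toric functions with an isolated singularity\<close>

lemma isolated_singularity_finite:
  assumes "isolated_singularity_at_0 \<Omega> f" "z \<in> \<Omega>" "z \<noteq> 0"
  obtains c :: real where "f z = ereal c"
proof -
  obtain r M where "r > 0" and bd: "\<And>w. w \<in> ball z r \<inter> (\<Omega> - {0}) \<Longrightarrow> \<bar>f w\<bar> \<le> ereal M"
    using assms unfolding isolated_singularity_at_0_def by blast
  then have "\<bar>f z\<bar> \<le> ereal M" using assms by simp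
  then show ?thesis using that by (cases "f z") auto
qed

lemma isolated_singularity_bounded:
  assumes iso: "isolated_singularity_at_0 \<Omega> f" and "compact S" "S \<subseteq> \<Omega> - {0}"
  obtains M :: real where "\<And>z. z \<in> S \<Longrightarrow> \<bar>f z\<bar> \<le> ereal M"
proof -
  define U where "U m = \<Union>{W. open W \<and> (\<forall>z\<in>W \<inter> (\<Omega> - {0}). \<bar>f z\<bar> \<le> ereal m)}" for m :: real
  have "S \<subseteq> (\<Union>m\<in>UNIV. U m)"
  proof
    fix z assume z: "z \<in> S"
    then obtain r M where "r > 0" "\<forall>w\<in>ball z r \<inter> (\<Omega> - {0}). \<bar>f w\<bar> \<le> ereal M"
      using iso assms(3) unfolding isolated_singularity_at_0_def by blast
    then have "ball z r \<subseteq> U M" unfolding U_def by auto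
    then have "z \<in> U M" using \<open>r > 0\<close> by auto
    then show "z \<in> (\<Union>m\<in>UNIV. U m)" by blast
  qed
  moreover have "open (U m)" for m by (auto simp: U_def)
  ultimately obtain C where C: "finite C" "S \<subseteq> (\<Union>m\<in>C. U m)"
    using compactE_image[OF \<open>compact S\<close>, of UNIV U] by metis
  have "\<bar>f z\<bar> \<le> ereal (Max C)" if z: "z \<in> S" for z
  proof -
    obtain m where m: "m \<in> C" "z \<in> U m" using C z by blast
    then have "\<bar>f z\<bar> \<le> ereal m" using z assms(3) unfolding U_def by blast
    also have "\<dots> \<le> ereal (Max C)" using m C by simp
    finally show ?thesis .
  qed
  then show ?thesis using that by blast
qed

lemma norm_axis_complex: "norm (axis j c :: complex ^ 'n) = cmod c"
  by (simp add: norm_vec_def L2_set_def axis_def if_distrib[of "\<lambda>x. x\<^sup>2"] if_distrib[of norm] cong: if_cong)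

lemma toric_axis_radial:
  assumes tor: "toric_on \<Omega> f" and R: "ball 0 R \<subseteq> \<Omega>" and \<zeta>: "cmod \<zeta> < R"
  shows "f (axis j \<zeta>) = f (axis j (of_real (cmod \<zeta>)))"
proof (rule tor[unfolded toric_on_def, rule_format])
  show "axis j \<zeta> \<in> \<Omega>" "axis j (of_real (cmod \<zeta>)) \<in> \<Omega>"
    using R \<zeta> by (auto simp: norm_axis_complex)
qed (simp add: axis_def)

lemma psh_submean:
  assumes "psh_on \<Omega> f" "ball 0 R \<subseteq> \<Omega>" "\<And>\<zeta>. \<zeta> \<in> cball 0 1 \<Longrightarrow> norm (z + \<zeta> *s w) < R"
  shows "f z \<le> circle_mean (\<lambda>\<theta>. f (z + cis \<theta> *s w))"
proof -
  have "\<forall>\<zeta>\<in>cball 0 1. z + \<zeta> *s w \<in> \<Omega>"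
    using assms(2,3) by (metis dist_0_norm mem_ball subsetD)
  then show ?thesis using assms(1) unfolding psh_on_def by blast
qed

text \<open>
  The sub-mean value inequality on the disc centred at the axis point \<open>axis j (z $ j)\<close> with direction
  \<open>z - axis j (z $ j)\<close>. Its boundary points have the same coordinate moduli as \<open>z\<close>, so \<open>f\<close> is constantly
  \<open>f z\<close> there.
\<close>

lemma toric_psh_ge_axis:
  assumes psh: "psh_on \<Omega> f" and tor: "toric_on \<Omega> f" and iso: "isolated_singularity_at_0 \<Omega> f"
    and R: "ball 0 R \<subseteq> \<Omega>" and z: "norm z < R" "z \<noteq> 0"
  shows "f (axis j (z $ j)) \<le> f z"
proof -
  let ?a = "axis j (z $ j)" and ?w = "z - axis j (z $ j)"
  have comp: "(?a + \<zeta> *s ?w) $ i = (if i = j then z $ i else \<zeta> * z $ i)" for \<zeta> i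
    by (simp add: axis_def)
  have small: "norm (?a + \<zeta> *s ?w) < R" if "\<zeta> \<in> cball 0 1" for \<zeta>
  proof -
    have "norm (?a + \<zeta> *s ?w) \<le> norm z"
      using that unfolding comp
      by (intro norm_le_componentwise_cart)
         (simp only: comp, auto simp: norm_mult mult_left_le_one_le)
    then show ?thesis using z by simp
  qed
  have "z \<in> \<Omega>" using R z by auto
  then obtain c where c: "f z = ereal c"
    using isolated_singularity_finite[OF iso _ z(2)] by blast
  have "f (?a + cis \<theta> *s ?w) = ereal c" for \<theta>
  proof -
    have "?a + cis \<theta> *s ?w \<in> \<Omega>" using small[of "cis \<theta>"] R by auto
    moreover have "\<forall>i. cmod ((?a + cis \<theta> *s ?w) $ i) = cmod (z $ i)"
      unfolding comp by (simp add: norm_mult)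
    ultimately show ?thesis using tor c \<open>z \<in> \<Omega>\<close> unfolding toric_on_def by metis
  qed
  then have "f ?a \<le> circle_mean (\<lambda>\<theta>. ereal c)"
    using psh_submean[OF psh R small] by simp
  also have "circle_mean (\<lambda>\<theta>. ereal c) = ereal ((2 * pi * c) / (2 * pi))"
    using has_integral_const_real[of c 0 "2 * pi"] by (intro circle_mean_continuous) auto
  finally show ?thesis using c by simp
qed

text \<open>
  The restriction of \<open>f\<close> to an axis is radial, and its profile \<open>k\<close> inherits upper semicontinuity and the
  sub-mean value inequality on discs missing the origin. Upper semicontinuity at the origin itself, where
  \<open>f\<close> is \<open>-\<infinity>\<close>, supplies the upper bound near \<open>-\<infinity>\<close> that the slope argument needs.
\<close>

lemma partial_lelong_limit:
  fixes \<Omega> :: "(complex ^ 'n) set"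
  assumes psh: "psh_on \<Omega> f" and tor: "toric_on \<Omega> f" and iso: "isolated_singularity_at_0 \<Omega> f"
    and R: "0 < R" "ball 0 R \<subseteq> \<Omega>"
    and k: "\<And>r. 0 < r \<Longrightarrow> r < R \<Longrightarrow> f (axis j (of_real r)) = ereal (k r)"
  shows "\<exists>L. ((\<lambda>t. k (exp t) / t) \<longlongrightarrow> L) at_bot \<and> partial_lelong f j = ereal L"
proof -
  have mem: "axis j \<zeta> \<in> \<Omega>" if "cmod \<zeta> < R" for \<zeta>
    using that R by (auto simp: norm_axis_complex)
  have kf: "f (axis j \<zeta>) = ereal (k (cmod \<zeta>))" if "0 < cmod \<zeta>" "cmod \<zeta> < R" for \<zeta>
    using toric_axis_radial[OF tor R(2) that(2)] k[OF that] by simp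
  have usc: "\<forall>\<^sub>F s in at r. f (axis j (of_real s)) < c"
    if r: "0 \<le> r" "r < R" "f (axis j (of_real r)) < c" for r c
  proof -
    have "\<forall>\<^sub>F w in at (axis j (of_real r)) within \<Omega>. f w < c"
      using psh mem[of "of_real r"] r unfolding psh_on_def usc_on_def by auto
    moreover have "filterlim (\<lambda>s. axis j (of_real s)) (at (axis j (complex_of_real r)) within \<Omega>) (at r)"
      unfolding filterlim_at
    proof
      have "\<forall>\<^sub>F s in at r. \<bar>s\<bar> < R"
      proof (rule order_tendstoD)
        show "((\<lambda>s. \<bar>s\<bar>) \<longlongrightarrow> \<bar>r\<bar>) (at r)" by (intro tendsto_intros)
      qed (use r in simp)
      moreover have "\<forall>\<^sub>F s in at r. s \<noteq> r" by (simp add: eventually_at_filter)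
      ultimately show "\<forall>\<^sub>F s in at r. axis j (complex_of_real s) \<in> \<Omega> \<and>
          axis j (complex_of_real s) \<noteq> axis j (complex_of_real r)"
        by eventually_elim (auto intro!: mem simp: axis_eq_axis)
      show "((\<lambda>s. axis j (complex_of_real s)) \<longlongrightarrow> axis j (complex_of_real r)) (at r)"
      proof (rule vec_tendstoI)
        show "((\<lambda>s. axis j (complex_of_real s) $ i) \<longlongrightarrow> axis j (complex_of_real r) $ i) (at r)" for i
          by (cases "i = j") (auto simp: axis_def intro!: tendsto_intros)
      qed
    qed
    ultimately show ?thesis by (rule eventually_compose_filterlim)
  qed
  have "convex_on {..<ln R} (\<lambda>t. k (exp t))"
  proof (rule log_convex_radial)
    fix r c assume r: "0 < r" "r < R" "k r < c"
    have "\<forall>\<^sub>F s in at r. f (axis j (of_real s)) < ereal c"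
      using usc[of r c] r k[of r] by simp
    moreover have "\<forall>\<^sub>F s in at r. 0 < s" "\<forall>\<^sub>F s in at r. s < R"
      using r by (auto intro: order_tendstoD[OF tendsto_ident_at])
    ultimately show "\<forall>\<^sub>F s in at r. k s < c"
      by eventually_elim (simp add: k)
  next
    fix r \<rho> :: real assume \<rho>: "0 < \<rho>" "\<rho> < r" "r + \<rho> < R"
    have axis: "axis j (of_real r) + \<zeta> *s axis j (of_real \<rho>) = axis j (of_real r + of_real \<rho> * \<zeta>)"
      for \<zeta> :: complex
      by (simp add: vec_eq_iff axis_def)
    have le: "r - \<rho> \<le> cmod (of_real r + of_real \<rho> * \<zeta>)" "cmod (of_real r + of_real \<rho> * \<zeta>) \<le> r + \<rho>"
      if "cmod \<zeta> \<le> 1" for \<zeta>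
    proof -
      have "\<rho> * cmod \<zeta> \<le> \<rho> * 1" using that \<rho> by (intro mult_left_mono) auto
      moreover have "cmod (of_real r + of_real \<rho> * \<zeta>) \<le> r + \<rho> * cmod \<zeta>"
        "r - \<rho> * cmod \<zeta> \<le> cmod (of_real r + of_real \<rho> * \<zeta>)"
        using norm_triangle_ineq[of "of_real r" "of_real \<rho> * \<zeta>"]
          norm_triangle_ineq2[of "of_real r" "- (of_real \<rho> * \<zeta>)"] \<rho>
        by (auto simp: norm_mult)
      ultimately show "r - \<rho> \<le> cmod (of_real r + of_real \<rho> * \<zeta>)" "cmod (of_real r + of_real \<rho> * \<zeta>) \<le> r + \<rho>"
        by linarith+
    qed
    have "f (axis j (of_real r)) \<le>
        circle_mean (\<lambda>\<theta>. f (axis j (of_real r) + cis \<theta> *s axis j (of_real \<rho>)))"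
    proof (rule psh_submean[OF psh R(2)])
      show "norm (axis j (of_real r) + \<zeta> *s axis j (of_real \<rho>)) < R" if "\<zeta> \<in> cball 0 1" for \<zeta> :: complex
        using le(2)[of \<zeta>] that \<rho> by (simp add: axis norm_axis_complex)
    qed
    moreover have "f (axis j (of_real r + of_real \<rho> * cis \<theta>)) =
        ereal (k (cmod (of_real r + of_real \<rho> * cis \<theta>)))" for \<theta>
      using le[of "cis \<theta>"] \<rho> by (intro kf) auto
    ultimately show "ereal (k r) \<le> circle_mean (\<lambda>\<theta>. ereal (k (cmod (of_real r + of_real \<rho> * cis \<theta>))))"
      using k[of r] \<rho> by (simp add: axis)
  qed (fact R)
  moreover have "\<forall>\<^sub>F t in at_bot. k (exp t) \<le> 0"
  proof -
    have "f (axis j 0) = -\<infinity>"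
    proof -
      have axis_0: "axis j 0 = (0 :: complex ^ 'n)" by (simp add: vec_eq_iff axis_def)
      show ?thesis
        using iso[unfolded isolated_singularity_at_0_def] by (simp only: axis_0)
    qed
    then have "\<forall>\<^sub>F s in at 0. f (axis j (of_real s)) < 0"
      using usc[of 0 0] R by simp
    then obtain d where d: "d > 0" "\<And>s. s \<noteq> 0 \<Longrightarrow> \<bar>s\<bar> < d \<Longrightarrow> f (axis j (of_real s)) < 0"
      by (auto simp: eventually_at)
    have "k (exp t) \<le> 0" if "t < ln (min d R)" for t
    proof -
      have "exp t < min d R" using that d R by (metis exp_less_mono exp_ln min_less_iff_conj)
      then show ?thesis using d(2)[of "exp t"] k[of "exp t"] by (simp add: less_imp_le)
    qed
    then show ?thesis unfolding eventually_at_bot_dense by blast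
  qed
  ultimately obtain L where L: "((\<lambda>t. k (exp t) / t) \<longlongrightarrow> L) at_bot"
    using convex_slope_at_bot by blast
  have "((\<lambda>t. (SUP \<zeta>\<in>{\<zeta>. cmod \<zeta> = exp t}. f (axis j \<zeta>)) / ereal t) \<longlongrightarrow> ereal L) at_bot"
  proof (rule Lim_transform_eventually)
    show "((\<lambda>t. ereal (k (exp t) / t)) \<longlongrightarrow> ereal L) at_bot" using L by simp
    have "ereal (k (exp t) / t) = (SUP \<zeta>\<in>{\<zeta>. cmod \<zeta> = exp t}. f (axis j \<zeta>)) / ereal t"
      if t: "t < min 0 (ln R)" for t
    proof -
      have "exp t < R" using t R by (metis exp_less_mono exp_ln min_less_iff_conj)
      then have "f (axis j \<zeta>) = ereal (k (exp t))" if "cmod \<zeta> = exp t" for \<zeta>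
        using kf[of \<zeta>] that by simp
      moreover have "cmod (of_real (exp t)) = exp t" by simp
      then have "{\<zeta>. cmod \<zeta> = exp t} \<noteq> {}" by blast
      ultimately have "(SUP \<zeta>\<in>{\<zeta>. cmod \<zeta> = exp t}. f (axis j \<zeta>)) = ereal (k (exp t))"
        by (simp cong: SUP_cong_simp)
      then show ?thesis using t by simp
    qed
    then show "\<forall>\<^sub>F t in at_bot. ereal (k (exp t) / t) =
        (SUP \<zeta>\<in>{\<zeta>. cmod \<zeta> = exp t}. f (axis j \<zeta>)) / ereal t"
      unfolding eventually_at_bot_dense by blast
  qed
  then have "partial_lelong f j = ereal L"
    unfolding partial_lelong_def by (intro tendsto_Lim) simp_all
  with L show ?thesis by blast
qed

text \<open>
  The axis bounds \<open>f (axis j \<zeta>) \<ge> a ln |\<zeta>|\<close> hold for small \<open>|\<zeta>|\<close> because the quotient \<open>k(e\<^sup>t)/t\<close> ends up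
  below \<open>a\<close>, and \<open>t\<close> is negative. Some coordinate of \<open>z\<close> has modulus at least \<open>|z|/n\<close>, since \<open>|z|\<close> is at most the
  sum of the moduli.
\<close>

lemma toric_psh_lower_bound:
  fixes \<Omega> :: "(complex ^ 'n) set"
  assumes psh: "psh_on \<Omega> f" and tor: "toric_on \<Omega> f" and iso: "isolated_singularity_at_0 \<Omega> f"
    and "0 \<in> \<Omega>" and a: "\<And>j. partial_lelong f j < ereal a" "0 < a"
  obtains r where "0 < r" "\<And>z. 0 < norm z \<Longrightarrow> norm z < r \<Longrightarrow>
    ereal (a * ln (norm z / real CARD('n))) \<le> f z"
proof -
  have "open \<Omega>" using psh by (simp add: psh_on_def)
  then obtain R where R: "0 < R" "ball 0 R \<subseteq> \<Omega>" using \<open>0 \<in> \<Omega>\<close> by (meson openE)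
  have "\<exists>s. 0 < s \<and> (\<forall>\<zeta>. 0 < cmod \<zeta> \<longrightarrow> cmod \<zeta> < s \<longrightarrow> ereal (a * ln (cmod \<zeta>)) \<le> f (axis j \<zeta>))" for j
  proof -
    define k where "k r = real_of_ereal (f (axis j (of_real r)))" for r :: real
    have k: "f (axis j \<zeta>) = ereal (k (cmod \<zeta>))" if \<zeta>: "0 < cmod \<zeta>" "cmod \<zeta> < R" for \<zeta>
    proof -
      have mem: "axis j (of_real (cmod \<zeta>)) \<in> \<Omega>"
        using \<zeta> R by (auto simp: norm_axis_complex)
      have "f (axis j \<zeta>) = f (axis j (of_real (cmod \<zeta>)))"
        by (rule toric_axis_radial[OF tor R(2) \<zeta>(2)])
      moreover obtain c where "f (axis j (of_real (cmod \<zeta>))) = ereal c"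
        using isolated_singularity_finite[OF iso mem] \<zeta> by (auto simp: axis_eq_0_iff)
      ultimately show ?thesis by (simp add: k_def)
    qed
    obtain L where L: "((\<lambda>t. k (exp t) / t) \<longlongrightarrow> L) at_bot" "partial_lelong f j = ereal L"
      using partial_lelong_limit[OF psh tor iso R, of j k] k by fastforce
    have "\<forall>\<^sub>F t in at_bot. k (exp t) / t < a"
      using order_tendstoD(2)[OF L(1), of a] a(1)[of j] L(2) by simp
    then obtain N where N: "\<And>t. t < N \<Longrightarrow> k (exp t) / t < a"
      by (auto simp: eventually_at_bot_dense)
    define s where "s = min R (min 1 (exp N))"
    have "ereal (a * ln (cmod \<zeta>)) \<le> f (axis j \<zeta>)" if \<zeta>: "0 < cmod \<zeta>" "cmod \<zeta> < s" for \<zeta>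
    proof -
      have "ln (cmod \<zeta>) < N" "ln (cmod \<zeta>) < 0"
        using \<zeta> ln_less_cancel_iff[of "cmod \<zeta>" "exp N"] by (simp_all add: s_def)
      then have "a * ln (cmod \<zeta>) \<le> k (cmod \<zeta>)"
        using N[of "ln (cmod \<zeta>)"] \<zeta> by (simp add: divide_less_eq)
      then show ?thesis using k[of \<zeta>] \<zeta> by (simp add: s_def)
    qed
    moreover have "0 < s" using R by (simp add: s_def)
    ultimately show ?thesis by blast
  qed
  then obtain s where s: "\<And>j. 0 < s j"
    "\<And>j \<zeta>. 0 < cmod \<zeta> \<Longrightarrow> cmod \<zeta> < s j \<Longrightarrow> ereal (a * ln (cmod \<zeta>)) \<le> f (axis j \<zeta>)" by metis
  define r where "r = Min (insert R (range s))"
  have "0 < r" "r \<le> R" using s R by (auto simp: r_def)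
  moreover have "r \<le> s j" for j unfolding r_def by (intro Min_le) auto
  ultimately have r: "0 < r" "r \<le> R" "\<And>j. r \<le> s j" .
  have "ereal (a * ln (norm z / real CARD('n))) \<le> f z" if z: "0 < norm z" "norm z < r" for z
  proof -
    have "\<exists>j. norm z / real CARD('n) \<le> cmod (z $ j)"
    proof (rule ccontr)
      assume "\<not> ?thesis"
      then have "(\<Sum>j\<in>UNIV. cmod (z $ j)) < (\<Sum>j\<in>(UNIV :: 'n set). norm z / real CARD('n))"
        by (intro sum_strict_mono) (auto simp: not_le)
      also have "\<dots> = norm z" by simp
      also have "\<dots> \<le> (\<Sum>j\<in>UNIV. cmod (z $ j))" by (simp add: norm_vec_def L2_set_le_sum)
      finally show False by simp
    qed
    then obtain j where j: "norm z / real CARD('n) \<le> cmod (z $ j)" ..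
    have pos: "0 < norm z / real CARD('n)" using z by simp
    have "cmod (z $ j) < s j" using z r(3)[of j] Finite_Cartesian_Product.norm_nth_le[of z j] by linarith
    moreover have "a * ln (norm z / real CARD('n)) \<le> a * ln (cmod (z $ j))"
      using ln_mono[OF j pos] a(2) by simp
    ultimately have "ereal (a * ln (norm z / real CARD('n))) \<le> f (axis j (z $ j))"
      using s(2)[of "z $ j" j] j pos by (meson ereal_less_eq(3) less_le_trans order_trans)
    also have "\<dots> \<le> f z"
      using toric_psh_ge_axis[OF psh tor iso R(2), of z j] z r by auto
    finally show ?thesis .
  qed
  then show ?thesis using that r by blast
qed

section \<open>Integration against a Hausdorff-Riesz measure\<close>

text \<open>
  If \<open>2\<^sup>-\<^sup>i\<^sup>-\<^sup>1 \<le> |z| < 2\<^sup>-\<^sup>i\<close> then \<open>|z|\<^sup>-\<^sup>a \<le> 2\<^sup>a\<^sup>(\<^sup>i\<^sup>+\<^sup>1\<^sup>)\<close>, and the ball of radius \<open>2\<^sup>-\<^sup>i\<close> has mass at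
  most \<open>2\<^sup>-\<^sup>i\<^sup>m\<close>. Summing over \<open>i\<close> gives a geometric series with ratio \<open>2\<^sup>a\<^sup>-\<^sup>m < 1\<close>.
\<close>

lemma hausdorff_riesz_power_integral_finite:
  fixes \<mu> :: "(complex ^ 'n) measure"
  assumes \<mu>: "\<mu> \<in> hausdorff_riesz m" and "0 < a" "a < m"
  shows "(\<integral>\<^sup>+z. ennreal (norm z powr (- a)) * indicator (ball 0 1 - {0}) z \<partial>\<mu>) < \<infinity>"
proof -
  interpret finite_measure \<mu> using \<mu> by (simp add: hausdorff_riesz_def)
  have sets: "sets \<mu> = sets (restrict_space borel (ball 0 1))"
    and growth: "\<And>r. r > 0 \<Longrightarrow> measure \<mu> (ball 0 r \<inter> ball 0 1) \<le> r powr m"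
    using \<mu> by (auto simp: hausdorff_riesz_def)
  define q :: real where "q = 2 powr (a - m)"
  have q: "0 < q" "q < 1" using assms by (auto simp: q_def powr_less_one)
  let ?B = "\<lambda>i::nat. ball 0 ((1/2) ^ i) \<inter> ball 0 1 :: (complex ^ 'n) set"
  let ?h = "\<lambda>i z. ennreal (2 powr (a * (real i + 1))) * indicator (?B i) z"
  have B: "?B i \<in> sets \<mu>" for i
    unfolding sets by (subst sets_restrict_space_iff) auto
  have single: "g i \<le> suminf g" for g :: "nat \<Rightarrow> ennreal" and i
    using sum_le_suminf[of g "{i}"] by simp
  have half: "(1/2) ^ i = (2::real) powr (- real i)" for i
    by (simp add: powr_minus_divide power_one_over powr_realpow)
  have dominate: "ennreal (norm z powr (- a)) * indicator (ball 0 1 - {0}) z \<le> (\<Sum>i. ?h i z)" for z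
  proof (cases "z \<in> ball 0 1 - {0}")
    case True
    (* The first dyadic radius not exceeding norm z; its predecessor gives a ball containing z. *)
    define n where "n = (LEAST i. (1/2) ^ i \<le> norm z)"
    have "\<exists>i. (1/2) ^ i < norm z" using True by (intro real_arch_pow_inv) auto
    then have n: "(1/2) ^ n \<le> norm z" unfolding n_def by (metis LeastI less_imp_le)
    have "n \<noteq> 0" using n True by (cases n) auto
    then obtain i where i: "n = Suc i" using not0_implies_Suc by blast
    then have "norm z < (1/2) ^ i" using not_less_Least[of i "\<lambda>i. (1/2) ^ i \<le> norm z"] by (simp add: n_def not_le)
    then have "z \<in> ?B i" using True by simp
    have "norm z powr (- a) \<le> ((1/2) ^ n) powr (- a)"
      using n assms by (intro powr_mono2') auto
    also have "\<dots> = 2 powr (a * (real i + 1))"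
      unfolding half powr_powr by (simp add: i algebra_simps)
    finally have "ennreal (norm z powr (- a)) * indicator (ball 0 1 - {0}) z \<le> ?h i z"
      using True \<open>z \<in> ?B i\<close> by (simp add: ennreal_leI)
    also have "\<dots> \<le> (\<Sum>i. ?h i z)"
      by (rule single)
    finally show ?thesis .
  qed simp
  have "(\<integral>\<^sup>+z. ennreal (norm z powr (- a)) * indicator (ball 0 1 - {0}) z \<partial>\<mu>) \<le>
      (\<integral>\<^sup>+z. (\<Sum>i. ?h i z) \<partial>\<mu>)"
    by (intro nn_integral_mono dominate)
  also have "\<dots> = (\<Sum>i. \<integral>\<^sup>+z. ?h i z \<partial>\<mu>)"
    by (intro nn_integral_suminf borel_measurable_times_ennreal borel_measurable_const
        borel_measurable_indicator B)
  also have "\<dots> \<le> (\<Sum>i. ennreal (2 powr a * q ^ i))"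
  proof (intro suminf_le allI)
    fix i
    have "(\<integral>\<^sup>+z. ?h i z \<partial>\<mu>) = ennreal (2 powr (a * (real i + 1)) * measure \<mu> (?B i))"
      using B by (simp add: nn_integral_cmult_indicator emeasure_eq_measure ennreal_mult)
    also have "\<dots> \<le> ennreal (2 powr (a * (real i + 1)) * ((1/2) ^ i) powr m)"
      using growth[of "(1/2) ^ i"] by (intro ennreal_leI mult_left_mono) auto
    also have "2 powr (a * (real i + 1)) * ((1/2) ^ i) powr m = 2 powr a * q ^ i"
    proof -
      have "q ^ i = 2 powr ((a - m) * real i)"
        by (simp add: q_def powr_powr flip: powr_realpow)
      moreover have "a * (real i + 1) + - real i * m = a + (a - m) * real i"
        by (simp add: algebra_simps)
      ultimately show ?thesis unfolding half powr_powr by (simp flip: powr_add)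
    qed
    finally show "(\<integral>\<^sup>+z. ?h i z \<partial>\<mu>) \<le> ennreal (2 powr a * q ^ i)" .
  qed auto
  also have "\<dots> < \<infinity>"
  proof -
    have "summable (\<lambda>i. 2 powr a * q ^ i)" using q by (intro summable_mult summable_geometric) auto
    then show ?thesis using q by (simp add: suminf_ennreal2 less_top)
  qed
  finally show ?thesis .
qed

theorem theorem16:
  fixes \<epsilon> :: real and \<Omega> K :: "(complex ^ 'n) set"
    and f \<phi> :: "complex ^ 'n \<Rightarrow> ereal" and u :: "complex ^ 'n \<Rightarrow> real" and \<nu> :: ereal
  assumes "0 < \<epsilon>" and "\<epsilon> \<le> 2"
    and "open \<Omega>" and "connected \<Omega>" and "0 \<in> \<Omega>"
    and "psh_on \<Omega> f" and "toric_on \<Omega> f" and "isolated_singularity_at_0 \<Omega> f"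
    and "psh_on \<Omega> \<phi>"
    and "compact K" and "K \<subseteq> \<Omega> \<inter> ball 0 1" and "0 \<in> interior K"
    and "\<forall>z\<in>K. \<phi> z \<ge> f z"
    and "\<forall>j. partial_lelong f j > 0"
    and "\<nu> = Max (range (partial_lelong f))"
    and "u \<in> U_eps \<epsilon>"
    and "\<nu> < ereal (2 * real CARD('n) - 2 + \<epsilon>)"
  shows "(\<integral>\<^sup>+z\<in>K. exp_ereal (- \<phi> z) \<partial>(monge_ampere (ball 0 1) u)) < \<infinity>"
proof -
  define m where "m = 2 * real CARD('n) - 2 + \<epsilon>"
  obtain \<mu> where \<mu>: "\<mu> \<in> hausdorff_riesz m" "monge_ampere (ball 0 1) u = \<mu>"
    using \<open>u \<in> U_eps \<epsilon>\<close> by (auto simp: U_eps_def solves_dirichlet_def m_def)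
  interpret finite_measure \<mu> using \<mu> by (simp add: hausdorff_riesz_def)
  have sets: "sets \<mu> = sets (restrict_space borel (ball 0 1))"
    using \<mu> by (simp add: hausdorff_riesz_def)
  obtain a where a: "\<nu> < ereal a" "a < m"
    using ereal_dense2[of \<nu> "ereal m"] \<open>\<nu> < _\<close> by (auto simp: m_def)
  have lelong: "partial_lelong f j < ereal a" for j
    using a(1) unfolding \<open>\<nu> = _\<close> by (auto intro: le_less_trans[OF Max_ge])
  have "0 < a"
    using \<open>\<forall>j. partial_lelong f j > 0\<close> lelong by (metis ereal_less(2) less_trans)
  obtain r where r: "0 < r" and near: "\<And>z. 0 < norm z \<Longrightarrow> norm z < r \<Longrightarrow>
      ereal (a * ln (norm z / real CARD('n))) \<le> f z"
    using toric_psh_lower_bound[OF \<open>psh_on \<Omega> f\<close> \<open>toric_on \<Omega> f\<close> \<open>isolated_singularity_at_0 \<Omega> f\<close>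
        \<open>0 \<in> \<Omega>\<close> lelong \<open>0 < a\<close>] by blast
  have "compact (K - ball 0 r)" "K - ball 0 r \<subseteq> \<Omega> - {0}"
    using \<open>compact K\<close> \<open>K \<subseteq> _\<close> r by (auto intro: compact_diff)
  then obtain M where M: "\<And>z. z \<in> K - ball 0 r \<Longrightarrow> \<bar>f z\<bar> \<le> ereal M"
    using isolated_singularity_bounded[OF \<open>isolated_singularity_at_0 \<Omega> f\<close>] by blast
  (* The first entry absorbs the division by n in the logarithmic bound, the second one serves on the
     part of K away from 0, where norm z powr (- a) \<ge> 1. *)
  define A where "A = max (real CARD('n) powr a) (exp M)"
  have A: "0 \<le> A" by (simp add: A_def max.coboundedI2)
  have bound: "exp_ereal (- \<phi> z) \<le> ennreal A * ennreal (norm z powr (- a))" if z: "z \<in> K" "z \<noteq> 0" for z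
  proof -
    have "norm z < 1" using z \<open>K \<subseteq> _\<close> by auto
    obtain c where c: "ereal c \<le> f z" "exp (- c) \<le> A * norm z powr (- a)"
    proof (cases "norm z < r")
      case True
      have "exp (- (a * ln (norm z / real CARD('n)))) = real CARD('n) powr a * norm z powr (- a)"
        using z by (simp add: ln_div powr_def right_diff_distrib flip: exp_add)
      also have "\<dots> \<le> A * norm z powr (- a)" by (intro mult_right_mono) (auto simp: A_def)
      finally show ?thesis using near[of z] True z that by auto
    next
      case False
      then have "ereal (- M) \<le> f z" using M[of z] z by (cases "f z") auto
      moreover have "1 \<le> norm z powr (- a)"
        using powr_mono2'[of "- a" "norm z" 1] \<open>norm z < 1\<close> z \<open>0 < a\<close> by simp
      then have "exp M * 1 \<le> A * norm z powr (- a)"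
        using A by (intro mult_mono) (auto simp: A_def)
      ultimately show ?thesis using that[of "- M"] by simp
    qed
    have "ereal c \<le> \<phi> z" using c \<open>\<forall>z\<in>K. \<phi> z \<ge> f z\<close> z by (meson order_trans)
    then have "exp_ereal (- \<phi> z) \<le> ennreal (exp (- c))"
      by (cases "\<phi> z") (auto simp: exp_ereal_def intro!: ennreal_leI)
    also have "\<dots> \<le> ennreal (A * norm z powr (- a))" using c by (intro ennreal_leI)
    also have "\<dots> = ennreal A * ennreal (norm z powr (- a))"
      using A by (intro ennreal_mult) auto
    finally show ?thesis .
  qed
  (* The integrand may be infinite at 0, so the growth condition is used once more to show that the
     origin carries no mass; s is chosen with s powr m equal to half of the supposed mass. *)
  have "{0} \<in> sets \<mu>" unfolding sets by (auto simp: sets_restrict_space)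
  moreover have "measure \<mu> {0} = 0"
  proof (rule ccontr)
    assume "measure \<mu> {0} \<noteq> 0"
    then have pos: "0 < measure \<mu> {0}" by (simp add: zero_less_measure_iff)
    define s where "s = (measure \<mu> {0} / 2) powr (1 / m)"
    have "s > 0" using pos by (simp add: s_def)
    have "measure \<mu> {0} \<le> measure \<mu> (ball 0 s \<inter> ball 0 1)"
      using \<open>s > 0\<close> unfolding sets by (intro finite_measure_mono) (auto simp: sets sets_restrict_space)
    also have "\<dots> \<le> s powr m" using \<mu> \<open>s > 0\<close> by (auto simp: hausdorff_riesz_def)
    also have "\<dots> = measure \<mu> {0} / 2"
      using pos a \<open>0 < a\<close> by (simp add: s_def powr_powr)
    finally show False using pos by simp
  qed
  ultimately have null: "{0} \<in> null_sets \<mu>" by (simp add: null_sets_def emeasure_eq_measure)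
  have "(\<integral>\<^sup>+z\<in>K. exp_ereal (- \<phi> z) \<partial>\<mu>) \<le>
      (\<integral>\<^sup>+z. ennreal A * (ennreal (norm z powr (- a)) * indicator (ball 0 1 - {0}) z) \<partial>\<mu>)"
  proof (rule nn_integral_mono_AE, rule AE_I'[OF null], rule subsetI)
    fix z assume "z \<in> {z \<in> space \<mu>. \<not> exp_ereal (- \<phi> z) * indicator K z \<le>
      ennreal A * (ennreal (norm z powr (- a)) * indicator (ball 0 1 - {0}) z)}"
    then show "z \<in> {0}"
      using bound[of z] \<open>K \<subseteq> _\<close> by (cases "z \<in> K"; cases "z = 0") auto
  qed
  also have "\<dots> = ennreal A * (\<integral>\<^sup>+z. ennreal (norm z powr (- a)) * indicator (ball 0 1 - {0}) z \<partial>\<mu>)"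
  proof (rule nn_integral_cmult)
    have [measurable]: "ball 0 1 - {0 :: complex ^ 'n} \<in> sets borel"
      by (intro sets.Diff borel_open borel_closed) auto
    have "(\<lambda>z::complex^'n. ennreal (norm z powr (- a)) * indicator (ball 0 1 - {0}) z) \<in>
        borel_measurable (restrict_space borel (ball 0 1))"
      by (intro measurable_restrict_space1) measurable
    then show "(\<lambda>z. ennreal (norm z powr (- a)) * indicator (ball 0 1 - {0}) z) \<in> borel_measurable \<mu>"
      by (simp only: measurable_cong_sets[OF sets refl])
  qed
  also have "\<dots> < \<infinity>"
    using hausdorff_riesz_power_integral_finite[OF \<mu>(1) \<open>0 < a\<close> a(2)] by (simp add: ennreal_mult_less_top)
  finally show ?thesis by (simp add: \<mu>)
qed

end
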